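(* Let $G=(X,+,\leq)$ be an ordered group. Then: (a) $K(G)$ is the largest autonomous subset in $(X,\leq)$ which contains $0$ and is an antichain; (b) $I(G)(0)$ is the least subgroup of $G$ which contains $inc(0)\cup\{0\}$; the quotient group $G/I(G)(0)$ is totally ordered and the order on $G$ is isomorphic to the lexicographical sum of the order of $I(G)(0)$ indexed by the chain $G/I(G)(0)$; (c) if the order $\leq$ is a semiorder, then $A(G)$ is a convex normal subgroup and is the largest subgroup of $G$ which is an antichain.
   Context: Groups are written additively but are not assumed abelian. An ordered group is a group with a partial order preserved by all left and right translations. $inc(0)$ is the set of elements incomparable to $0$. Write $x\leq_{pred}y$ if for all $z$, $z<x$ implies $z<y$; this is a compatible quasi-order, and $K(G)$ denotes the equivalence class of $0$ for the associated equivalence $x\leq_{pred}y$ and $y\leq_{pred}x$ (a normal subgroup). $I(G)(0)$ denotes the connected component of $0$ in the incomparability graph of $(X,\leq)$, whose edges are the pairs of incomparable elements (this is a convex normal subgroup of $G$). $A(G):=\{x\in G: \mathbb{Z}x \text{ is an antichain in } G\}$, where $\mathbb{Z}x=\{nx:n\in\mathbb{Z}\}$. An antichain is a set of pairwise incomparable elements. A subset $Y$ of $X$ is autonomous if for all $y,y'\in Y$ and $x\in X\setminus Y$, $x\leq y$ is equivalent to $x\leq y'$ and $y\leq x$ is equivalent to $y'\leq x$. A subset is convex if it contains every element lying between two of its elements. For a normal subgroup $H$, $G/H$ carries the image relation: $a'\leq_H b'$ if $a\leq b$ for some $a\in a'$, $b\in b'$. The lexicographical sum of pairwise disjoint posets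 $P_i$ ($i\in I$) indexed by a poset $I$ is the order on the union in which $x\leq y$ iff $x,y$ lie in the same $P_i$ and $x\leq y$ there, or $x\in P_i$, $y\in P_j$ with $i<j$. An order is a semiorder if it embeds neither $2\oplus 2$ nor $3\oplus 1$, where $r\oplus s$ is the disjoint union of an $r$-element chain and an $s$-element chain with no comparabilities between them. *)

theory Defs
  imports "HOL-Algebra.Coset"
begin

text \<open>
  Orders are reflexive relations \<open>r\<close> on an explicit carrier \<open>X\<close>, in the sense of
  \<^const>\<open>partial_order_on\<close>. Groups are written multiplicatively, as everywhere in HOL-Algebra;
  they are not assumed to be commutative.
\<close>

locale ordered_group = group G for G (structure) +
  fixes r :: "'a rel"
  assumes partial_order: "partial_order_on (carrier G) r"
    and left_translation:
      "\<lbrakk>(x, y) \<in> r; z \<in> carrier G\<rbrakk> \<Longrightarrow> (z \<otimes> x, z \<otimes> y) \<in> r"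
    and right_translation:
      "\<lbrakk>(x, y) \<in> r; z \<in> carrier G\<rbrakk> \<Longrightarrow> (x \<otimes> z, y \<otimes> z) \<in> r"

definition incomparability :: "'a set \<Rightarrow> 'a rel \<Rightarrow> 'a rel" where
  "incomparability X r = {(x, y). x \<in> X \<and> y \<in> X \<and> (x, y) \<notin> r \<and> (y, x) \<notin> r}"

definition inc :: "'a set \<Rightarrow> 'a rel \<Rightarrow> 'a \<Rightarrow> 'a set" where
  "inc X r x = incomparability X r `` {x}"

definition incomparability_component :: "'a set \<Rightarrow> 'a rel \<Rightarrow> 'a \<Rightarrow> 'a set" where
  "incomparability_component X r x = (incomparability X r)\<^sup>* `` {x}"

text \<open>Pairwise incomparability concerns distinct elements, so singletons are antichains.\<close>

definition antichain_in :: "'a set \<Rightarrow> 'a rel \<Rightarrow> 'a set \<Rightarrow> bool" where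
  "antichain_in X r Y \<longleftrightarrow>
     Y \<subseteq> X \<and> pairwise (\<lambda>x y. (x, y) \<in> incomparability X r) Y"

definition autonomous_in :: "'a set \<Rightarrow> 'a rel \<Rightarrow> 'a set \<Rightarrow> bool" where
  "autonomous_in X r Y \<longleftrightarrow>
     Y \<subseteq> X \<and>
     (\<forall>y \<in> Y. \<forall>y' \<in> Y. \<forall>x \<in> X - Y.
        ((x, y) \<in> r \<longleftrightarrow> (x, y') \<in> r) \<and> ((y, x) \<in> r \<longleftrightarrow> (y', x) \<in> r))"

definition convex_in :: "'a set \<Rightarrow> 'a rel \<Rightarrow> 'a set \<Rightarrow> bool" where
  "convex_in X r Y \<longleftrightarrow>
     Y \<subseteq> X \<and>
     (\<forall>x \<in> Y. \<forall>y \<in> Y. \<forall>z \<in> X. (x, z) \<in> r \<and> (z, y) \<in> r \<longrightarrow> z \<in> Y)"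

definition pred_le :: "'a set \<Rightarrow> 'a rel \<Rightarrow> 'a rel" where
  "pred_le X r = {(x, y). x \<in> X \<and> y \<in> X \<and> (\<forall>z \<in> X. (z, x) \<in> r - Id \<longrightarrow> (z, y) \<in> r - Id)}"

definition K_set :: "('a, 'b) monoid_scheme \<Rightarrow> 'a rel \<Rightarrow> 'a set" where
  "K_set G r =
     {x \<in> carrier G. (x, \<one>\<^bsub>G\<^esub>) \<in> pred_le (carrier G) r \<and> (\<one>\<^bsub>G\<^esub>, x) \<in> pred_le (carrier G) r}"

definition I_set :: "('a, 'b) monoid_scheme \<Rightarrow> 'a rel \<Rightarrow> 'a set" where
  "I_set G r = incomparability_component (carrier G) r \<one>\<^bsub>G\<^esub>"

definition A_set :: "('a, 'b) monoid_scheme \<Rightarrow> 'a rel \<Rightarrow> 'a set" where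
  "A_set G r =
     {x \<in> carrier G. antichain_in (carrier G) r (range (\<lambda>n :: int. x [^]\<^bsub>G\<^esub> n))}"

definition quotient_order :: "('a, 'b) monoid_scheme \<Rightarrow> 'a rel \<Rightarrow> 'a set \<Rightarrow> 'a set rel" where
  "quotient_order G r H =
     {(a', b'). a' \<in> carrier (G Mod H) \<and> b' \<in> carrier (G Mod H) \<and>
                (\<exists>a \<in> a'. \<exists>b \<in> b'. (a, b) \<in> r)}"

text \<open>The union of the \<open>P i\<close> for \<open>i \<in> I\<close> is meant to be a disjoint one.\<close>

definition lex_sum :: "'i set \<Rightarrow> 'i rel \<Rightarrow> ('i \<Rightarrow> 'a set) \<Rightarrow> ('i \<Rightarrow> 'a rel) \<Rightarrow> 'a rel" where
  "lex_sum I s P R =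
     {(x, y). (\<exists>i \<in> I. x \<in> P i \<and> y \<in> P i \<and> (x, y) \<in> R i) \<or>
              (\<exists>i \<in> I. \<exists>j \<in> I. x \<in> P i \<and> y \<in> P j \<and> (i, j) \<in> s - Id)}"

text \<open>
  The lexicographical sum of a single poset \<open>(Y, r)\<close> indexed by \<open>(I, s)\<close>: the summands are the
  pairwise disjoint copies \<open>{i} \<times> Y\<close>, and the underlying set is \<open>I \<times> Y\<close>.
\<close>

definition lex_sum_copies :: "'i set \<Rightarrow> 'i rel \<Rightarrow> 'a set \<Rightarrow> 'a rel \<Rightarrow> ('i \<times> 'a) rel" where
  "lex_sum_copies I s Y r =
     lex_sum I s (\<lambda>i. {i} \<times> Y) (\<lambda>i. {((i, x), (i, y)) | x y. (x, y) \<in> r})"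

definition order_isomorphic :: "'a set \<Rightarrow> 'a rel \<Rightarrow> 'b set \<Rightarrow> 'b rel \<Rightarrow> bool" where
  "order_isomorphic X r Y s \<longleftrightarrow>
     (\<exists>f. bij_betw f X Y \<and> (\<forall>x \<in> X. \<forall>y \<in> X. (x, y) \<in> r \<longleftrightarrow> (f x, f y) \<in> s))"

definition order_embeds :: "'a set \<Rightarrow> 'a rel \<Rightarrow> 'b set \<Rightarrow> 'b rel \<Rightarrow> bool" where
  "order_embeds X r Y s \<longleftrightarrow>
     (\<exists>f. inj_on f X \<and> f ` X \<subseteq> Y \<and> (\<forall>x \<in> X. \<forall>y \<in> X. (x, y) \<in> r \<longleftrightarrow> (f x, f y) \<in> s))"

definition two_chains_carrier :: "nat \<Rightarrow> nat \<Rightarrow> (nat + nat) set" where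
  "two_chains_carrier m n = {..<m} <+> {..<n}"

definition two_chains :: "nat \<Rightarrow> nat \<Rightarrow> (nat + nat) rel" where
  "two_chains m n =
     {(Inl i, Inl j) | i j. i \<le> j \<and> j < m} \<union> {(Inr i, Inr j) | i j. i \<le> j \<and> j < n}"

definition semiorder_on :: "'a set \<Rightarrow> 'a rel \<Rightarrow> bool" where
  "semiorder_on X r \<longleftrightarrow>
     partial_order_on X r \<and>
     \<not> order_embeds (two_chains_carrier 2 2) (two_chains 2 2) X r \<and>
     \<not> order_embeds (two_chains_carrier 3 1) (two_chains 3 1) X r"

end

theory Submission
  imports Defs "HOL-Algebra.Generated_Groups"
begin

text \<open>
  Everything rests on the fact that translations are order automorphisms, so that any relation
  defined from the order alone is determined by its behaviour at the identity.

  The first part says that an antichain containing \<open>\<one>\<close> is autonomous only if its members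
  have the same strict predecessors as \<open>\<one>\<close>. Conversely, elements with the same strict
  predecessors also have the same strict successors: inversion reverses both the order and the
  relation \<^const>\<open>pred_le\<close> (\<open>pred_le_inv\<close>). This symmetry makes the class of \<open>\<one>\<close> autonomous.

  For the second part, an element outside a connected component of the incomparability graph is
  comparable to each of its members, and cannot change sides along an edge of that graph.
  Consequently it lies above the whole component or below the whole component. The components are
  the cosets of the component of \<open>\<one>\<close>, so distinct cosets are completely ordered against each
  other (\<open>coset_le_coset\<close>); that is what a totally ordered quotient and a lexicographical sum
  amount to. Choosing a representative of each coset identifies the coset with the component of
  \<open>\<one>\<close> by a translation, which makes all summands isomorphic.

  For the third part, the exclusion of \<open>2 \<oplus> 2\<close> makes the sets of strict predecessors a chain, so
  \<^const>\<open>pred_le\<close> is a total quasi-order compatible with the multiplication. The strictly positive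
  elements form an up-set for it. Given two elements none of whose powers is positive, one
  element \<open>c\<close> among these two and their inverses dominates the other three, so the \<open>n\<close>-th power of
  their product, or of its inverse, is dominated by the \<open>2 n\<close>-th power of \<open>c\<close> and cannot be
  positive either. So \<^const>\<open>A_set\<close> is closed under products; its other properties are formal.
\<close>

section \<open>Predecessor sets in orders without two parallel edges\<close>

lemma two_plus_two_embeds:
  assumes "partial_order_on X r"
    and "(z, x) \<in> r" "z \<noteq> x" "(w, y) \<in> r" "w \<noteq> y"
    and "(z, y) \<notin> r" "(w, x) \<notin> r"
  shows "order_embeds (two_chains_carrier 2 2) (two_chains 2 2) X r"
proof -
  have po: "refl_on X r" "trans r" "antisym r" "r \<subseteq> X \<times> X"
    using partial_order_onD[OF assms(1)] by auto
  have in_X: "x \<in> X" "y \<in> X" "z \<in> X" "w \<in> X"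
    using assms po(4) by auto
  have refl: "(x, x) \<in> r" "(y, y) \<in> r" "(z, z) \<in> r" "(w, w) \<in> r"
    using in_X po(1) by (auto simp: refl_on_def)
  \<comment> \<open>By transitivity, the two missing edges exclude all edges between the two chains.\<close>
  have no: "(x, z) \<notin> r" "(y, w) \<notin> r" "(z, w) \<notin> r" "(w, z) \<notin> r"
    "(x, w) \<notin> r" "(w, x) \<notin> r" "(y, z) \<notin> r" "(z, y) \<notin> r" "(x, y) \<notin> r" "(y, x) \<notin> r"
    using assms po(2,3) by (meson antisymD transD)+
  have neq: "z \<noteq> w" "z \<noteq> y" "x \<noteq> w" "x \<noteq> y"
    using no refl by auto
  let ?f = "\<lambda>s :: nat + nat.
    case s of Inl i \<Rightarrow> (if i = 0 then z else x) | Inr j \<Rightarrow> (if j = 0 then w else y)"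
  have carrier: "two_chains_carrier 2 2 = {Inl 0, Inl 1, Inr 0, Inr 1}"
    by (auto simp: two_chains_carrier_def less_2_cases_iff)
  show ?thesis
    unfolding order_embeds_def
  proof (intro exI[of _ ?f] conjI)
    show "inj_on ?f (two_chains_carrier 2 2)"
      unfolding carrier using neq assms(3,5) by (auto simp: inj_on_def)
    show "?f ` two_chains_carrier 2 2 \<subseteq> X"
      unfolding carrier using in_X by auto
    show "\<forall>s\<in>two_chains_carrier 2 2. \<forall>t\<in>two_chains_carrier 2 2.
      ((s, t) \<in> two_chains 2 2) = ((?f s, ?f t) \<in> r)"
      unfolding carrier using no refl assms(2,4) by (auto simp: two_chains_def)
  qed
qed

text \<open>
  Predecessors \<open>z\<close> of \<open>x\<close> alone and \<open>w\<close> of \<open>y\<close> alone would yield the disjoint edges \<open>z < x\<close> and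
  \<open>w < y\<close> of a copy of \<open>2 \<oplus> 2\<close>.
\<close>

lemma pred_le_total:
  assumes po: "partial_order_on X r"
    and no22: "\<not> order_embeds (two_chains_carrier 2 2) (two_chains 2 2) X r"
    and "x \<in> X" "y \<in> X"
  shows "(x, y) \<in> pred_le X r \<or> (y, x) \<in> pred_le X r"
proof (rule ccontr)
  assume "\<not> ?thesis"
  then obtain z w where z: "(z, x) \<in> r - Id" "(z, y) \<notin> r - Id"
    and w: "(w, y) \<in> r - Id" "(w, x) \<notin> r - Id"
    using assms(3,4) unfolding pred_le_def by blast
  \<comment> \<open>\<open>z = y\<close> would give \<open>w < y < x\<close>, and \<open>w = x\<close> would give \<open>z < x < y\<close>.\<close>
  have "z \<noteq> y" "w \<noteq> x"
    using z w partial_order_onD(2,3)[OF po] by (auto dest: transD antisymD)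
  then show False
    using two_plus_two_embeds[OF po, of z x w y] z w no22 by auto
qed

section \<open>Translations in an ordered group\<close>

context ordered_group
begin

abbreviation le (infix "\<preceq>" 50) where "x \<preceq> y \<equiv> (x, y) \<in> r"

abbreviation less (infix "\<prec>" 50) where "x \<prec> y \<equiv> (x, y) \<in> r - Id"

abbreviation incomparable (infix "\<parallel>" 50) where
  "x \<parallel> y \<equiv> (x, y) \<in> incomparability (carrier G) r"

abbreviation pred_less_eq (infix "\<lesssim>" 50) where
  "x \<lesssim> y \<equiv> (x, y) \<in> pred_le (carrier G) r"

lemma le_carrier: "x \<preceq> y \<Longrightarrow> x \<in> carrier G \<and> y \<in> carrier G"
  using partial_order_onD(4)[OF partial_order] by auto

lemma le_refl: "x \<in> carrier G \<Longrightarrow> x \<preceq> x"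
  using partial_order_onD(1)[OF partial_order] by (auto simp: refl_on_def)

lemma le_trans: "x \<preceq> y \<Longrightarrow> y \<preceq> z \<Longrightarrow> x \<preceq> z"
  using partial_order_onD(2)[OF partial_order] by (rule transD)

lemma le_antisym: "x \<preceq> y \<Longrightarrow> y \<preceq> x \<Longrightarrow> x = y"
  using partial_order_onD(3)[OF partial_order] by (rule antisymD)

lemma le_cancel_left:
  assumes "x \<in> carrier G" "y \<in> carrier G" "z \<in> carrier G"
  shows "z \<otimes> x \<preceq> z \<otimes> y \<longleftrightarrow> x \<preceq> y"
  using assms left_translation[of "z \<otimes> x" "z \<otimes> y" "inv z"] left_translation[of x y z]
  by (auto simp flip: m_assoc)

lemma le_cancel_right:
  assumes "x \<in> carrier G" "y \<in> carrier G" "z \<in> carrier G"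
  shows "x \<otimes> z \<preceq> y \<otimes> z \<longleftrightarrow> x \<preceq> y"
  using assms right_translation[of "x \<otimes> z" "y \<otimes> z" "inv z"] right_translation[of x y z]
  by (auto simp: m_assoc)

lemma less_cancel_left:
  assumes "x \<in> carrier G" "y \<in> carrier G" "z \<in> carrier G"
  shows "z \<otimes> x \<prec> z \<otimes> y \<longleftrightarrow> x \<prec> y"
  using assms by (simp add: le_cancel_left)

lemma less_cancel_right:
  assumes "x \<in> carrier G" "y \<in> carrier G" "z \<in> carrier G"
  shows "x \<otimes> z \<prec> y \<otimes> z \<longleftrightarrow> x \<prec> y"
  using assms by (simp add: le_cancel_right)

lemma less_inv:
  assumes "x \<in> carrier G" "y \<in> carrier G"
  shows "inv y \<prec> inv x \<longleftrightarrow> x \<prec> y"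
  using less_cancel_left[of "inv y" "inv x" x] less_cancel_right[of "x \<otimes> inv y" \<one> y] assms
  by (simp add: m_assoc)

lemma incomparable_left:
  assumes "x \<parallel> y" "z \<in> carrier G"
  shows "z \<otimes> x \<parallel> z \<otimes> y"
  using assms by (auto simp: incomparability_def le_cancel_left)

lemma incomparable_right:
  assumes "x \<parallel> y" "z \<in> carrier G"
  shows "x \<otimes> z \<parallel> y \<otimes> z"
  using assms by (auto simp: incomparability_def le_cancel_right)

section \<open>The class of the identity for the predecessor quasi-order\<close>

lemma pred_le_less: "x \<lesssim> y \<Longrightarrow> z \<prec> x \<Longrightarrow> z \<prec> y"
  using le_carrier[of z x] by (simp add: pred_le_def)

lemma pred_le_trans: "x \<lesssim> y \<Longrightarrow> y \<lesssim> z \<Longrightarrow> x \<lesssim> z"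
  by (auto simp: pred_le_def)

lemma pred_le_left:
  assumes "x \<lesssim> y" "c \<in> carrier G"
  shows "c \<otimes> x \<lesssim> c \<otimes> y"
proof -
  have carr: "x \<in> carrier G" "y \<in> carrier G"
    using assms(1) by (auto simp: pred_le_def)
  have "z \<prec> c \<otimes> y" if z: "z \<in> carrier G" "z \<prec> c \<otimes> x" for z
  proof -
    have "inv c \<otimes> z \<prec> x"
      using less_cancel_left[of "inv c \<otimes> z" x c] z assms carr by (simp flip: m_assoc)
    then have "inv c \<otimes> z \<prec> y"
      using assms(1) by (rule pred_le_less[rotated])
    then show ?thesis
      using less_cancel_left[of "inv c \<otimes> z" y c] z assms carr by (simp flip: m_assoc)
  qed
  then show ?thesis
    using assms carr unfolding pred_le_def by blast
qed

lemma pred_le_right: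
  assumes "x \<lesssim> y" "c \<in> carrier G"
  shows "x \<otimes> c \<lesssim> y \<otimes> c"
proof -
  have carr: "x \<in> carrier G" "y \<in> carrier G"
    using assms(1) by (auto simp: pred_le_def)
  have "z \<prec> y \<otimes> c" if z: "z \<in> carrier G" "z \<prec> x \<otimes> c" for z
  proof -
    have "z \<otimes> inv c \<prec> x"
      using less_cancel_right[of "z \<otimes> inv c" x c] z assms carr by (simp add: m_assoc)
    then have "z \<otimes> inv c \<prec> y"
      using assms(1) by (rule pred_le_less[rotated])
    then show ?thesis
      using less_cancel_right[of "z \<otimes> inv c" y c] z assms carr by (simp add: m_assoc)
  qed
  then show ?thesis
    using assms carr unfolding pred_le_def by blast
qed

lemma pred_le_inv:
  assumes "x \<lesssim> y"
  shows "inv y \<lesssim> inv x"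
proof -
  have carr: "x \<in> carrier G" "y \<in> carrier G"
    using assms by (auto simp: pred_le_def)
  have "inv x \<otimes> x \<otimes> inv y \<lesssim> inv x \<otimes> y \<otimes> inv y"
    using assms carr by (intro pred_le_left pred_le_right) auto
  then show ?thesis
    using carr by (simp add: m_assoc)
qed

text \<open>Inversion turns strict successors into strict predecessors and reverses \<open>\<lesssim>\<close>.\<close>

lemma pred_le_greater:
  assumes "x \<lesssim> y" "y \<prec> z"
  shows "x \<prec> z"
proof -
  have carr: "x \<in> carrier G" "y \<in> carrier G" "z \<in> carrier G"
    using assms le_carrier[of y z] by (auto simp: pred_le_def)
  have "inv z \<prec> inv x"
    using pred_le_less[OF pred_le_inv[OF assms(1)]] less_inv[of y z] assms(2) carr by blast
  then show ?thesis
    using less_inv carr by blast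
qed

lemma pred_equivalent_if_in_K_set:
  assumes "x \<in> K_set G r" "y \<in> K_set G r"
  shows "x \<lesssim> y"
  using assms pred_le_trans unfolding K_set_def by blast

lemma one_in_K_set: "\<one> \<in> K_set G r"
  by (simp add: K_set_def pred_le_def)

lemma antichain_K_set: "antichain_in (carrier G) r (K_set G r)"
proof -
  have "\<not> x \<prec> y" if "x \<in> K_set G r" "y \<in> K_set G r" for x y
    using pred_le_less[OF pred_equivalent_if_in_K_set[OF that(2,1)], of x] by blast
  then show ?thesis
    by (auto simp: antichain_in_def pairwise_def incomparability_def K_set_def)
qed

lemma autonomous_K_set: "autonomous_in (carrier G) r (K_set G r)"
  unfolding autonomous_in_def
proof (intro conjI ballI)
  show "K_set G r \<subseteq> carrier G"
    by (auto simp: K_set_def)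
  fix y y' x
  assume y: "y \<in> K_set G r" "y' \<in> K_set G r" and x: "x \<in> carrier G - K_set G r"
  have "y \<lesssim> y'" "y' \<lesssim> y"
    using y by (auto intro: pred_equivalent_if_in_K_set)
  moreover have "x \<noteq> y" "x \<noteq> y'"
    using x y by auto
  ultimately show "x \<preceq> y \<longleftrightarrow> x \<preceq> y'" "y \<preceq> x \<longleftrightarrow> y' \<preceq> x"
    using pred_le_less[of y y' x] pred_le_less[of y' y x]
      pred_le_greater[of y y' x] pred_le_greater[of y' y x] by auto
qed

text \<open>
  A strict predecessor of a member of an antichain lies outside the antichain, where autonomy
  applies.
\<close>

lemma pred_le_if_autonomous_antichain:
  assumes "autonomous_in (carrier G) r Y" "antichain_in (carrier G) r Y" "x \<in> Y" "y \<in> Y"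
  shows "x \<lesssim> y"
proof -
  have "z \<prec> y" if z: "z \<in> carrier G" "z \<prec> x" for z
  proof -
    have "z \<notin> Y"
      using z assms(2,3) by (auto simp: antichain_in_def pairwise_def incomparability_def)
    then show ?thesis
      using z assms unfolding autonomous_in_def by blast
  qed
  then show ?thesis
    using assms unfolding pred_le_def autonomous_in_def by blast
qed

lemma autonomous_antichain_subset_K_set:
  assumes "autonomous_in (carrier G) r Y" "antichain_in (carrier G) r Y" "\<one> \<in> Y"
  shows "Y \<subseteq> K_set G r"
proof
  fix y assume y: "y \<in> Y"
  have "y \<lesssim> \<one>" "\<one> \<lesssim> y"
    using pred_le_if_autonomous_antichain[OF assms(1,2)] y assms(3) by blast+
  moreover have "y \<in> carrier G"
    using y assms(2) by (auto simp: antichain_in_def)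
  ultimately show "y \<in> K_set G r"
    unfolding K_set_def by blast
qed

section \<open>The component of the identity in the incomparability graph\<close>

abbreviation connected_to (infix "\<approx>" 50) where
  "x \<approx> y \<equiv> (x, y) \<in> (incomparability (carrier G) r)\<^sup>*"

lemma I_set_iff: "x \<in> I_set G r \<longleftrightarrow> \<one> \<approx> x"
  by (simp add: I_set_def incomparability_component_def)

lemma connected_sym: "x \<approx> y \<Longrightarrow> y \<approx> x"
proof -
  have "sym (incomparability (carrier G) r)"
    by (auto simp: sym_def incomparability_def)
  then show "x \<approx> y \<Longrightarrow> y \<approx> x"
    by (meson symD sym_rtrancl)
qed

lemma connected_carrier: "x \<approx> y \<Longrightarrow> x \<in> carrier G \<Longrightarrow> y \<in> carrier G"
  by (induction rule: rtrancl_induct) (auto simp: incomparability_def)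

lemma connected_left: "x \<approx> y \<Longrightarrow> z \<in> carrier G \<Longrightarrow> z \<otimes> x \<approx> z \<otimes> y"
  by (induction rule: rtrancl_induct) (auto intro: incomparable_left rtrancl_into_rtrancl)

lemma connected_right: "x \<approx> y \<Longrightarrow> z \<in> carrier G \<Longrightarrow> x \<otimes> z \<approx> y \<otimes> z"
  by (induction rule: rtrancl_induct) (auto intro: incomparable_right rtrancl_into_rtrancl)

text \<open>
  The component is closed under the operations because translations and conjugations are
  automorphisms of the incomparability graph: they map paths to paths.
\<close>

lemma subgroup_I_set: "subgroup (I_set G r) G"
proof (rule subgroupI)
  show "I_set G r \<subseteq> carrier G"
    using connected_carrier by (auto simp: I_set_iff)
  show "I_set G r \<noteq> {}"
    by (auto simp: I_set_iff)
  fix x assume x: "x \<in> I_set G r"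
  then have carr: "x \<in> carrier G"
    using connected_carrier by (auto simp: I_set_iff)
  show "inv x \<in> I_set G r"
    using connected_left[of \<one> x "inv x"] connected_sym x carr by (simp add: I_set_iff)
  fix y assume "y \<in> I_set G r"
  then show "x \<otimes> y \<in> I_set G r"
    using connected_left[of \<one> y x] x carr by (auto simp: I_set_iff intro: rtrancl_trans)
qed

lemma normal_I_set: "I_set G r \<lhd> G"
  unfolding normal_inv_iff
proof (intro conjI ballI)
  show "subgroup (I_set G r) G"
    by (rule subgroup_I_set)
  fix g x assume g: "g \<in> carrier G" and x: "x \<in> I_set G r"
  have "g \<otimes> \<one> \<otimes> inv g \<approx> g \<otimes> x \<otimes> inv g"
    using g x by (intro connected_left connected_right) (auto simp: I_set_iff)
  then show "g \<otimes> x \<otimes> inv g \<in> I_set G r"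
    using g by (simp add: I_set_iff)
qed

lemma inc_subset_I_set: "inc (carrier G) r \<one> \<union> {\<one>} \<subseteq> I_set G r"
  by (auto simp: I_set_iff inc_def)

text \<open>
  Along an edge \<open>x \<parallel> y\<close> the quotient \<open>x\<^sup>-\<^sup>1 y\<close> is incomparable to \<open>\<one>\<close>, so a subgroup
  containing these elements contains every path that starts at \<open>\<one>\<close>.
\<close>

lemma I_set_least:
  assumes H: "subgroup H G" and inc: "inc (carrier G) r \<one> \<subseteq> H"
  shows "I_set G r \<subseteq> H"
proof
  fix x assume "x \<in> I_set G r"
  then have "\<one> \<approx> x"
    by (simp add: I_set_iff)
  then show "x \<in> H"
  proof (induction rule: rtrancl_induct)
    case base
    show ?case
      using H by (rule subgroup.one_closed)
  next
    case (step x y)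
    have carr: "x \<in> carrier G" "y \<in> carrier G"
      using step by (auto simp: incomparability_def)
    have "inv x \<otimes> x \<parallel> inv x \<otimes> y"
      using step carr by (intro incomparable_left) auto
    then have "inv x \<otimes> y \<in> H"
      using inc carr by (auto simp: inc_def)
    then have "x \<otimes> (inv x \<otimes> y) \<in> H"
      using step H by (auto intro: subgroup.m_closed)
    then show ?case
      using carr by (simp flip: m_assoc)
  qed
qed

text \<open>
  If \<open>x \<preceq> y\<close> and \<open>x \<parallel> x'\<close>, then \<open>y \<preceq> x'\<close> is impossible; so when \<open>y\<close> is comparable to \<open>x'\<close>,
  it stays above.
\<close>

lemma connected_below:
  assumes "x \<approx> x'" "x \<preceq> y" "\<not> x \<approx> y"
  shows "x' \<preceq> y"
  using assms
proof (induction rule: rtrancl_induct)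
  case (step u v)
  then have "u \<preceq> y"
    by simp
  have carr: "y \<in> carrier G" "v \<in> carrier G"
    using step le_carrier[of x y] by (auto simp: incomparability_def)
  have "\<not> v \<parallel> y"
    using step by (meson rtrancl_into_rtrancl)
  moreover have "\<not> y \<preceq> v"
    using \<open>u \<preceq> y\<close> step le_trans[of u y v] by (auto simp: incomparability_def)
  ultimately show ?case
    using carr by (auto simp: incomparability_def)
qed

lemma connected_above:
  assumes "y \<approx> y'" "x \<preceq> y" "\<not> x \<approx> y"
  shows "x \<preceq> y'"
  using assms
proof (induction rule: rtrancl_induct)
  case (step u v)
  then have "x \<preceq> u"
    by simp
  have carr: "x \<in> carrier G" "v \<in> carrier G"
    using step le_carrier[of x y] by (auto simp: incomparability_def)
  have "y \<approx> v"
    using step by (meson rtrancl_into_rtrancl)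
  then have "\<not> x \<parallel> v"
    using step connected_sym by (meson r_into_rtrancl rtrancl_trans)
  moreover have "\<not> v \<preceq> x"
    using \<open>x \<preceq> u\<close> step le_trans[of v x u] by (auto simp: incomparability_def)
  ultimately show ?case
    using carr by (auto simp: incomparability_def)
qed

lemma I_set_coset_iff:
  assumes "x \<in> carrier G" "y \<in> carrier G"
  shows "I_set G r #> x = I_set G r #> y \<longleftrightarrow> x \<approx> y"
proof -
  have "I_set G r #> x = I_set G r #> y \<longleftrightarrow> y \<otimes> inv x \<in> I_set G r"
    using assms subgroup_I_set
    by (metis group.repr_independenceD group_axioms repr_independence
        subgroup.rcos_module)
  also have "\<dots> \<longleftrightarrow> x \<approx> y"
    using connected_right[of \<one> "y \<otimes> inv x" x] connected_right[of x y "inv x"] assms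
    by (auto simp: I_set_iff m_assoc)
  finally show ?thesis .
qed

abbreviation I_coset where "I_coset x \<equiv> I_set G r #> x"

abbreviation I_quotient where "I_quotient \<equiv> carrier (G Mod I_set G r)"

lemma I_quotient_cases:
  assumes "A \<in> I_quotient"
  obtains x where "x \<in> carrier G" "A = I_coset x"
  using assms by (auto simp: carrier_FactGroup)

lemma in_I_coset_iff:
  assumes "x \<in> carrier G"
  shows "y \<in> I_coset x \<longleftrightarrow> x \<approx> y"
proof
  assume y: "y \<in> I_coset x"
  then have "y \<in> carrier G"
    using assms subgroup.elemrcos_carrier[OF subgroup_I_set is_group] by blast
  then show "x \<approx> y"
    using repr_independence[OF y assms subgroup_I_set] I_set_coset_iff assms by blast
next
  assume xy: "x \<approx> y"
  then have y: "y \<in> carrier G"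
    using connected_carrier assms by blast
  show "y \<in> I_coset x"
    using I_set_coset_iff[OF assms y] xy y subgroup_I_set by (simp add: rcos_self)
qed

lemma I_coset_quotient_le:
  "x \<preceq> y \<Longrightarrow> (I_coset x, I_coset y) \<in> quotient_order G r (I_set G r)"
  using le_carrier[of x y] rcos_self[OF _ subgroup_I_set]
  unfolding quotient_order_def carrier_FactGroup by blast

text \<open>
  If some \<open>a\<close> in the coset of \<open>x\<close> lies below some \<open>b\<close> in the coset of \<open>y\<close>, then \<open>b\<close> can be moved
  to \<open>y\<close> and afterwards \<open>a\<close> to \<open>x\<close> within their components: representatives do not matter.
\<close>

lemma coset_le_coset:
  assumes "x \<in> carrier G" "y \<in> carrier G" "\<not> x \<approx> y"
  shows "(I_coset x, I_coset y) \<in> quotient_order G r (I_set G r) \<longleftrightarrow> x \<preceq> y"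
proof
  assume "(I_coset x, I_coset y) \<in> quotient_order G r (I_set G r)"
  then obtain a b where ab: "x \<approx> a" "y \<approx> b" "a \<preceq> b"
    using assms by (auto simp: quotient_order_def in_I_coset_iff)
  have "\<not> a \<approx> b" "\<not> a \<approx> y"
    using ab assms connected_sym by (meson rtrancl_trans)+
  then show "x \<preceq> y"
    using ab connected_sym connected_above[of b y a] connected_below[of a x y] by blast
next
  assume "x \<preceq> y"
  then show "(I_coset x, I_coset y) \<in> quotient_order G r (I_set G r)"
    by (rule I_coset_quotient_le)
qed

lemma quotient_le_cases:
  assumes "(A, B) \<in> quotient_order G r (I_set G r)"
  obtains x y where "x \<preceq> y" "A = I_coset x" "B = I_coset y"
proof -
  obtain x y where xy: "x \<in> A" "y \<in> B" "x \<preceq> y" and AB: "A \<in> I_quotient" "B \<in> I_quotient"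
    using assms by (auto simp: quotient_order_def)
  obtain a b where ab: "a \<in> carrier G" "A = I_coset a" "b \<in> carrier G" "B = I_coset b"
    using AB by (meson I_quotient_cases)
  have "A = I_coset x" "B = I_coset y"
    using xy ab subgroup_I_set by (auto dest: repr_independence)
  then show thesis
    using that xy by blast
qed

lemma partial_order_quotient:
  "partial_order_on I_quotient (quotient_order G r (I_set G r))"
  unfolding partial_order_on_def preorder_on_def
proof (intro conjI)
  show "quotient_order G r (I_set G r) \<subseteq> I_quotient \<times> I_quotient"
    by (auto simp: quotient_order_def)
  show "refl_on I_quotient (quotient_order G r (I_set G r))"
    by (auto intro!: refl_onI I_coset_quotient_le le_refl elim!: I_quotient_cases)
  show "trans (quotient_order G r (I_set G r))"
  proof (rule transI)
    fix A B C
    assume AB: "(A, B) \<in> quotient_order G r (I_set G r)"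
      and BC: "(B, C) \<in> quotient_order G r (I_set G r)"
    from AB obtain x y where xy: "x \<preceq> y" "A = I_coset x" "B = I_coset y"
      by (rule quotient_le_cases)
    from BC obtain y' z where yz: "y' \<preceq> z" "B = I_coset y'" "C = I_coset z"
      by (rule quotient_le_cases)
    show "(A, C) \<in> quotient_order G r (I_set G r)"
    proof (cases "x \<approx> y")
      case True
      then have "A = B"
        using xy le_carrier I_set_coset_iff by blast
      then show ?thesis
        using BC by simp
    next
      case False
      have "y \<approx> y'"
        using xy yz le_carrier I_set_coset_iff by metis
      then have "x \<preceq> y'"
        using connected_above xy False by blast
      then show ?thesis
        using xy yz le_trans I_coset_quotient_le by blast
    qed
  qed
  show "antisym (quotient_order G r (I_set G r))"
  proof (rule antisymI)
    fix A B
    assume AB: "(A, B) \<in> quotient_order G r (I_set G r)"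
      and BA: "(B, A) \<in> quotient_order G r (I_set G r)"
    from AB obtain x y where xy: "x \<preceq> y" "A = I_coset x" "B = I_coset y"
      by (rule quotient_le_cases)
    have carr: "x \<in> carrier G" "y \<in> carrier G"
      using le_carrier xy by auto
    show "A = B"
    proof (cases "y \<approx> x")
      case True
      then show ?thesis
        using xy carr connected_sym I_set_coset_iff by blast
    next
      case False
      then show ?thesis
        using coset_le_coset[of y x] xy carr BA le_antisym by blast
    qed
  qed
qed

lemma linear_order_quotient:
  "linear_order_on I_quotient (quotient_order G r (I_set G r))"
proof -
  have "total_on I_quotient (quotient_order G r (I_set G r))"
  proof (rule total_onI)
    fix A B assume A: "A \<in> I_quotient" and B: "B \<in> I_quotient" and "A \<noteq> B"
    obtain x where x: "x \<in> carrier G" "A = I_coset x"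
      using A by (rule I_quotient_cases)
    obtain y where y: "y \<in> carrier G" "B = I_coset y"
      using B by (rule I_quotient_cases)
    have "\<not> x \<parallel> y"
      using x y \<open>A \<noteq> B\<close> I_set_coset_iff by blast
    then show "(A, B) \<in> quotient_order G r (I_set G r) \<or> (B, A) \<in> quotient_order G r (I_set G r)"
      using x y I_coset_quotient_le by (auto simp: incomparability_def)
  qed
  then show ?thesis
    using partial_order_quotient by (simp add: linear_order_on_def)
qed

lemma I_coset_mult:
  "x \<in> carrier G \<Longrightarrow> y \<in> carrier G \<Longrightarrow> I_coset x \<otimes>\<^bsub>G Mod I_set G r\<^esub> I_coset y = I_coset (x \<otimes> y)"
  using normal.rcos_sum[OF normal_I_set] by simp

lemma ordered_group_quotient:
  "ordered_group (G Mod I_set G r) (quotient_order G r (I_set G r))"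
proof -
  interpret Q: group "G Mod I_set G r"
    using normal_I_set by (rule normal.factorgroup_is_group)
  show ?thesis
  proof
    show "partial_order_on I_quotient (quotient_order G r (I_set G r))"
      by (rule partial_order_quotient)
    fix A B C
    assume AB: "(A, B) \<in> quotient_order G r (I_set G r)" and C: "C \<in> I_quotient"
    from AB obtain x y where xy: "x \<preceq> y" "A = I_coset x" "B = I_coset y"
      by (rule quotient_le_cases)
    from C obtain z where z: "z \<in> carrier G" "C = I_coset z"
      by (rule I_quotient_cases)
    have "z \<otimes> x \<preceq> z \<otimes> y" "x \<otimes> z \<preceq> y \<otimes> z"
      using xy z left_translation right_translation by auto
    then show "(C \<otimes>\<^bsub>G Mod I_set G r\<^esub> A, C \<otimes>\<^bsub>G Mod I_set G r\<^esub> B) \<in> quotient_order G r (I_set G r)"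
      "(A \<otimes>\<^bsub>G Mod I_set G r\<^esub> C, B \<otimes>\<^bsub>G Mod I_set G r\<^esub> C) \<in> quotient_order G r (I_set G r)"
      using xy z le_carrier[of x y] by (auto simp only: I_coset_mult intro: I_coset_quotient_le)
  qed
qed

text \<open>
  The isomorphism sends \<open>x\<close> to its coset together with \<open>x c\<^sup>-\<^sup>1\<close>, where \<open>c\<close> is the chosen
  representative of the coset. Within a coset it is a translation in the second coordinate; between
  distinct cosets only the first coordinate counts, on both sides.
\<close>

lemma order_isomorphic_lex_sum:
  "order_isomorphic (carrier G) r (I_quotient \<times> I_set G r)
     (lex_sum_copies I_quotient (quotient_order G r (I_set G r)) (I_set G r)
        (Restr r (I_set G r)))"
proof -
  define rep where "rep A = (SOME c. c \<in> A)" for A :: "'a set"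
  have rep_in: "rep A \<in> A" if "A \<in> I_quotient" for A
  proof -
    obtain x where "x \<in> carrier G" "A = I_coset x"
      using \<open>A \<in> I_quotient\<close> by (rule I_quotient_cases)
    then have "x \<in> A"
      using subgroup_I_set by (simp add: rcos_self)
    then show ?thesis
      unfolding rep_def by (rule someI)
  qed
  have coset_mem: "I_coset x \<in> I_quotient" if "x \<in> carrier G" for x
    using that by (auto simp: carrier_FactGroup)
  have rep_connected: "x \<approx> rep (I_coset x)" if "x \<in> carrier G" for x
    using rep_in[OF coset_mem] that in_I_coset_iff by blast
  have rep_carr: "rep A \<in> carrier G" if A: "A \<in> I_quotient" for A
    using A rep_connected connected_carrier by (elim I_quotient_cases) blast
  have coset_rep: "I_coset (rep A) = A" if A: "A \<in> I_quotient" for A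
    using A
  proof (rule I_quotient_cases)
    fix x assume x: "x \<in> carrier G" "A = I_coset x"
    then show ?thesis
      using rep_connected[of x] rep_carr[OF A] I_set_coset_iff[of x "rep A"] by simp
  qed
  define f where "f x = (I_coset x, x \<otimes> inv (rep (I_coset x)))" for x
  \<comment> \<open>Multiplying by the representative inverts \<open>f\<close>.\<close>
  define g where "g = (\<lambda>(A, h). h \<otimes> rep A)"
  have f_mem: "f x \<in> I_quotient \<times> I_set G r" if x: "x \<in> carrier G" for x
  proof -
    have c: "rep (I_coset x) \<in> carrier G"
      using rep_carr coset_mem x by blast
    have "rep (I_coset x) \<otimes> inv (rep (I_coset x)) \<approx> x \<otimes> inv (rep (I_coset x))"
      using connected_right rep_connected[OF x] connected_sym c by blast
    then show ?thesis
      using c x coset_mem by (simp add: f_def I_set_iff)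
  qed
  have g_coset: "I_coset (g (A, h)) = A" if "A \<in> I_quotient" "h \<in> I_set G r" for A h
  proof -
    have h: "h \<in> carrier G"
      using that subgroup.mem_carrier[OF subgroup_I_set] by blast
    have "\<one> \<otimes> rep A \<approx> h \<otimes> rep A"
      using that rep_carr by (intro connected_right) (auto simp: I_set_iff)
    then have "I_coset (rep A) = I_coset (h \<otimes> rep A)"
      using that rep_carr h I_set_coset_iff[of "rep A" "h \<otimes> rep A"] by simp
    then show ?thesis
      using that coset_rep by (simp add: g_def)
  qed
  have bij: "bij_betw f (carrier G) (I_quotient \<times> I_set G r)"
  proof (rule bij_betw_byWitness[where f' = g])
    show "\<forall>x\<in>carrier G. g (f x) = x"
      using rep_carr coset_mem by (auto simp: f_def g_def m_assoc)
    show "\<forall>p\<in>I_quotient \<times> I_set G r. f (g p) = p"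
    proof
      fix p assume "p \<in> I_quotient \<times> I_set G r"
      then obtain A h where p: "p = (A, h)" "A \<in> I_quotient" "h \<in> I_set G r"
        by auto
      then have "h \<in> carrier G"
        using subgroup.mem_carrier[OF subgroup_I_set] by blast
      then show "f (g p) = p"
        using p g_coset[of A h] rep_carr[of A] by (simp add: f_def) (simp add: g_def m_assoc)
    qed
    show "f ` carrier G \<subseteq> I_quotient \<times> I_set G r"
      using f_mem by blast
    show "g ` (I_quotient \<times> I_set G r) \<subseteq> carrier G"
      using rep_carr subgroup.mem_carrier[OF subgroup_I_set] by (auto simp: g_def)
  qed
  have ord: "x \<preceq> y \<longleftrightarrow> (f x, f y) \<in> lex_sum_copies I_quotient (quotient_order G r (I_set G r))
        (I_set G r) (Restr r (I_set G r))"
    if x: "x \<in> carrier G" and y: "y \<in> carrier G" for x y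
  proof (cases "x \<approx> y")
    case True
    then have eq: "I_coset x = I_coset y"
      using I_set_coset_iff x y by blast
    have "x \<otimes> inv (rep (I_coset y)) \<preceq> y \<otimes> inv (rep (I_coset y)) \<longleftrightarrow> x \<preceq> y"
      using x y rep_carr[OF coset_mem] by (intro le_cancel_right) auto
    then show ?thesis
      using f_mem[OF x] f_mem[OF y] eq by (auto simp: f_def lex_sum_copies_def lex_sum_def)
  next
    case False
    then have "I_coset x \<noteq> I_coset y"
      using I_set_coset_iff x y by blast
    then show ?thesis
      using f_mem[OF x] f_mem[OF y] coset_le_coset[OF x y False]
      by (auto simp: f_def lex_sum_copies_def lex_sum_def)
  qed
  show ?thesis
    unfolding order_isomorphic_def using bij ord by blast
qed

section \<open>Elements generating antichains\<close>

text \<open>By translation, \<open>x\<^sup>m \<prec> x\<^sup>n\<close> amounts to \<open>\<one> \<prec> x\<^sup>n\<^sup>-\<^sup>m\<close>.\<close>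

lemma A_set_iff: "x \<in> A_set G r \<longleftrightarrow> x \<in> carrier G \<and> (\<forall>n :: int. \<not> \<one> \<prec> x [^] n)"
proof (intro iffI conjI allI notI)
  assume x: "x \<in> A_set G r"
  then show "x \<in> carrier G"
    by (simp add: A_set_def)
  fix n :: int assume n: "\<one> \<prec> x [^] n"
  have "\<one> \<in> range (\<lambda>k :: int. x [^] k)"
    by (rule range_eqI[of _ _ 0]) simp
  then have "\<one> \<parallel> x [^] n"
    using x n by (auto simp: A_set_def antichain_in_def pairwise_def)
  then show False
    using n by (auto simp: incomparability_def)
next
  assume x: "x \<in> carrier G \<and> (\<forall>n :: int. \<not> \<one> \<prec> x [^] n)"
  have not_less: "\<not> x [^] m \<prec> x [^] n" for m n :: int
  proof
    assume less: "x [^] m \<prec> x [^] n"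
    have "x [^] n = x [^] m \<otimes> x [^] (n - m)"
      using x by (simp flip: int_pow_mult)
    then have "x [^] m \<otimes> \<one> \<prec> x [^] m \<otimes> x [^] (n - m)"
      using less x by simp
    then have "\<one> \<prec> x [^] (n - m)"
      using x less_cancel_left[of \<one> "x [^] (n - m)" "x [^] m"] by blast
    then show False
      using x by blast
  qed
  have "x [^] m \<parallel> x [^] n" if "x [^] m \<noteq> x [^] n" for m n :: int
    using not_less[of m n] not_less[of n m] that x by (simp add: incomparability_def)
  then show "x \<in> A_set G r"
    using x by (auto simp: A_set_def antichain_in_def pairwise_def)
qed

lemma A_set_inv: "x \<in> A_set G r \<Longrightarrow> inv x \<in> A_set G r"
  by (metis A_set_iff int_pow_inv int_pow_neg inv_closed)

lemma pred_le_mult: "x \<lesssim> y \<Longrightarrow> x' \<lesssim> y' \<Longrightarrow> x \<otimes> x' \<lesssim> y \<otimes> y'"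
proof -
  assume "x \<lesssim> y" "x' \<lesssim> y'"
  moreover from this have "x' \<in> carrier G" "y \<in> carrier G"
    by (auto simp: pred_le_def)
  ultimately show ?thesis
    using pred_le_right pred_le_left pred_le_trans by meson
qed

lemma pred_le_pow: "x \<lesssim> y \<Longrightarrow> x [^] (n :: nat) \<lesssim> y [^] n"
  by (induction n) (simp_all add: pred_le_mult, simp add: pred_le_def)

text \<open>
  The dominating element plays the role of the larger of the two absolute values in a totally
  ordered group.
\<close>

lemma A_set_mult:
  assumes total: "\<And>x y. x \<in> carrier G \<Longrightarrow> y \<in> carrier G \<Longrightarrow> x \<lesssim> y \<or> y \<lesssim> x"
    and a: "a \<in> A_set G r" and b: "b \<in> A_set G r"
  shows "a \<otimes> b \<in> A_set G r"
proof -
  have carr: "x \<in> carrier G" if "x \<in> A_set G r" for x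
    using that by (simp add: A_set_iff)
  have refl: "x \<lesssim> x" if "x \<in> carrier G" for x
    using that by (simp add: pred_le_def)
  have abs: "\<exists>c \<in> A_set G r. x \<lesssim> c \<and> inv x \<lesssim> c" if "x \<in> A_set G r" for x
    using that carr[OF that] A_set_inv[OF that] total[of x "inv x"] refl[of x] refl[of "inv x"]
    by auto
  obtain a' where a': "a' \<in> A_set G r" "a \<lesssim> a'" "inv a \<lesssim> a'"
    using abs[OF a] by blast
  obtain b' where b': "b' \<in> A_set G r" "b \<lesssim> b'" "inv b \<lesssim> b'"
    using abs[OF b] by blast
  obtain c where c: "c \<in> A_set G r" "a \<lesssim> c" "inv a \<lesssim> c" "b \<lesssim> c" "inv b \<lesssim> c"
  proof (cases "a' \<lesssim> b'")
    case True
    then show thesis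
      using that[of b'] a' b' pred_le_trans[of _ a' b'] by blast
  next
    case False
    then have "b' \<lesssim> a'"
      using total a' b' carr by blast
    then show thesis
      using that[of a'] a' b' pred_le_trans[of _ b' a'] by blast
  qed
  have not_pos: "\<not> \<one> \<prec> x [^] (n :: nat)" if x: "x \<lesssim> c \<otimes> c" for x n
  proof
    assume "\<one> \<prec> x [^] n"
    then have "\<one> \<prec> (c \<otimes> c) [^] n"
      using pred_le_less pred_le_pow[OF x] by blast
    moreover have "(c \<otimes> c) [^] n = c [^] int (2 * n)"
      using carr[OF c(1)] nat_pow_pow[of c 2 n] nat_pow_Suc[of c] nat_pow_0[of c]
      by (simp only: int_pow_int numeral_2_eq_2 l_one)
    ultimately show False
      using c(1) by (metis A_set_iff)
  qed
  have ab: "a \<otimes> b \<lesssim> c \<otimes> c"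
    using c pred_le_mult by blast
  have inv_ab: "inv (a \<otimes> b) \<lesssim> c \<otimes> c"
    using c pred_le_mult[of "inv b" c "inv a" c] carr[OF a] carr[OF b]
    by (simp only: inv_mult_group)
  have "\<not> \<one> \<prec> (a \<otimes> b) [^] n" for n :: int
  proof (cases "n \<ge> 0")
    case True
    then have "(a \<otimes> b) [^] n = (a \<otimes> b) [^] nat n"
      by simp
    then show ?thesis
      using not_pos[OF ab] by metis
  next
    case False
    have "a \<otimes> b \<in> carrier G"
      using carr a b by simp
    then have "(a \<otimes> b) [^] n = inv (a \<otimes> b) [^] nat (- n)"
      using False int_pow_def2[of G "a \<otimes> b" n] nat_pow_inv by (metis not_le)
    then show ?thesis
      using not_pos[OF inv_ab] by metis
  qed
  then show ?thesis
    using carr a b by (simp add: A_set_iff)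
qed

lemma semiorder_subgroup_A_set:
  assumes "semiorder_on (carrier G) r"
  shows "subgroup (A_set G r) G"
proof (rule subgroupI)
  have "x \<lesssim> y \<or> y \<lesssim> x" if "x \<in> carrier G" "y \<in> carrier G" for x y
    using pred_le_total[OF partial_order] assms that by (simp add: semiorder_on_def)
  then show "a \<otimes> b \<in> A_set G r" if "a \<in> A_set G r" "b \<in> A_set G r" for a b
    using A_set_mult that by blast
  show "A_set G r \<subseteq> carrier G"
    by (auto simp: A_set_iff)
  have "\<one> \<in> A_set G r"
    by (simp add: A_set_iff)
  then show "A_set G r \<noteq> {}"
    by blast
qed (rule A_set_inv)

lemma conjugate_int_pow:
  assumes "g \<in> carrier G" "x \<in> carrier G"
  shows "(g \<otimes> x \<otimes> inv g) [^] (n :: int) = g \<otimes> x [^] n \<otimes> inv g"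
proof -
  have "(\<lambda>y. g \<otimes> y \<otimes> inv g) \<in> hom G G"
    using assms(1) by (auto simp: hom_def m_assoc simp flip: m_assoc[of "inv g" g])
  then show ?thesis
    using hom_int_pow[of "\<lambda>y. g \<otimes> y \<otimes> inv g" G G x n] assms is_group by simp
qed

lemma A_set_conjugate:
  assumes g: "g \<in> carrier G" and x: "x \<in> A_set G r"
  shows "g \<otimes> x \<otimes> inv g \<in> A_set G r"
proof -
  have carr: "x \<in> carrier G"
    using x by (simp add: A_set_iff)
  have "\<not> \<one> \<prec> (g \<otimes> x \<otimes> inv g) [^] n" for n :: int
  proof
    assume "\<one> \<prec> (g \<otimes> x \<otimes> inv g) [^] n"
    then have "g \<otimes> \<one> \<otimes> inv g \<prec> g \<otimes> x [^] n \<otimes> inv g"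
      using g carr by (simp add: conjugate_int_pow)
    then have "\<one> \<prec> x [^] n"
      using g carr less_cancel_right[of "g \<otimes> \<one>" "g \<otimes> x [^] n" "inv g"]
        less_cancel_left[of \<one> "x [^] n" g] by simp
    then show False
      using x A_set_iff by blast
  qed
  then show ?thesis
    using g carr by (simp add: A_set_iff)
qed

text \<open>
  Closure under quotients passes from antichains generated by single elements to the whole set:
  \<open>x \<prec> y\<close> would make the member \<open>x\<^sup>-\<^sup>1 y\<close> strictly positive.
\<close>

lemma antichain_A_set:
  assumes "subgroup (A_set G r) G"
  shows "antichain_in (carrier G) r (A_set G r)"
proof -
  have "\<not> x \<prec> y" if x: "x \<in> A_set G r" and y: "y \<in> A_set G r" for x y
  proof
    assume "x \<prec> y"
    moreover have carr: "x \<in> carrier G" "y \<in> carrier G"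
      using x y by (auto simp: A_set_iff)
    ultimately have "\<one> \<prec> (inv x \<otimes> y) [^] (1 :: int)"
      using less_cancel_left[of x y "inv x"] by simp
    moreover have "inv x \<otimes> y \<in> A_set G r"
      using assms x y by (simp add: subgroup.m_closed subgroup.m_inv_closed)
    ultimately show False
      using A_set_iff by blast
  qed
  moreover have "A_set G r \<subseteq> carrier G"
    using assms by (rule subgroup.subset)
  ultimately show ?thesis
    by (auto simp: antichain_in_def pairwise_def incomparability_def)
qed

lemma antichain_convex:
  assumes "antichain_in (carrier G) r Y"
  shows "convex_in (carrier G) r Y"
  unfolding convex_in_def
proof (intro conjI ballI impI)
  show "Y \<subseteq> carrier G"
    using assms by (simp add: antichain_in_def)
  fix x y z assume xy: "x \<in> Y" "y \<in> Y" and z: "x \<preceq> z \<and> z \<preceq> y"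
  then have "x \<preceq> y"
    using le_trans by blast
  then have "x = y"
    using assms xy by (auto simp: antichain_in_def pairwise_def incomparability_def)
  then show "z \<in> Y"
    using z xy le_antisym by blast
qed

lemma antichain_subgroup_subset_A_set:
  assumes H: "subgroup H G" and antichain: "antichain_in (carrier G) r H"
  shows "H \<subseteq> A_set G r"
proof
  fix x assume x: "x \<in> H"
  have "range (\<lambda>n :: int. x [^] n) \<subseteq> H"
    using subgroup_int_pow_closed[OF H x] by blast
  then show "x \<in> A_set G r"
    using antichain x by (auto simp: A_set_def antichain_in_def intro: pairwise_subset)
qed

end

section \<open>The three subgroups of an ordered group\<close>

theorem theorem15:
  fixes G :: "('a, 'b) monoid_scheme" and r :: "'a rel"
  assumes "ordered_group G r"
  shows
    "(autonomous_in (carrier G) r (K_set G r) \<and> \<one>\<^bsub>G\<^esub> \<in> K_set G r \<and>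
      antichain_in (carrier G) r (K_set G r) \<and>
      (\<forall>Y. autonomous_in (carrier G) r Y \<and> \<one>\<^bsub>G\<^esub> \<in> Y \<and> antichain_in (carrier G) r Y
           \<longrightarrow> Y \<subseteq> K_set G r))
     \<and>
     (subgroup (I_set G r) G \<and> inc (carrier G) r \<one>\<^bsub>G\<^esub> \<union> {\<one>\<^bsub>G\<^esub>} \<subseteq> I_set G r \<and>
      (\<forall>H. subgroup H G \<and> inc (carrier G) r \<one>\<^bsub>G\<^esub> \<union> {\<one>\<^bsub>G\<^esub>} \<subseteq> H \<longrightarrow> I_set G r \<subseteq> H) \<and>
      I_set G r \<lhd> G \<and>
      ordered_group (G Mod I_set G r) (quotient_order G r (I_set G r)) \<and>
      linear_order_on (carrier (G Mod I_set G r)) (quotient_order G r (I_set G r)) \<and>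
      order_isomorphic (carrier G) r
        (carrier (G Mod I_set G r) \<times> I_set G r)
        (lex_sum_copies (carrier (G Mod I_set G r)) (quotient_order G r (I_set G r))
           (I_set G r) (Restr r (I_set G r))))
     \<and>
     (semiorder_on (carrier G) r \<longrightarrow>
      convex_in (carrier G) r (A_set G r) \<and> A_set G r \<lhd> G \<and>
      antichain_in (carrier G) r (A_set G r) \<and>
      (\<forall>H. subgroup H G \<and> antichain_in (carrier G) r H \<longrightarrow> H \<subseteq> A_set G r))"
proof -
  interpret ordered_group G r
    by fact
  have A_normal: "A_set G r \<lhd> G" if "semiorder_on (carrier G) r"
    using semiorder_subgroup_A_set[OF that] A_set_conjugate by (simp add: normal_inv_iff)
  have A_antichain: "antichain_in (carrier G) r (A_set G r)" if "semiorder_on (carrier G) r"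
    using semiorder_subgroup_A_set[OF that] by (rule antichain_A_set)
  show ?thesis
  proof (intro conjI allI impI)
    fix Y assume "autonomous_in (carrier G) r Y \<and> \<one>\<^bsub>G\<^esub> \<in> Y \<and> antichain_in (carrier G) r Y"
    then show "Y \<subseteq> K_set G r"
      by (intro autonomous_antichain_subset_K_set) auto
  next
    fix H assume "subgroup H G \<and> inc (carrier G) r \<one>\<^bsub>G\<^esub> \<union> {\<one>\<^bsub>G\<^esub>} \<subseteq> H"
    then show "I_set G r \<subseteq> H"
      by (intro I_set_least) auto
  next
    fix H assume "subgroup H G \<and> antichain_in (carrier G) r H"
    then show "H \<subseteq> A_set G r"
      by (intro antichain_subgroup_subset_A_set) auto
  qed (rule autonomous_K_set one_in_K_set antichain_K_set subgroup_I_set inc_subset_I_set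
      normal_I_set ordered_group_quotient linear_order_quotient order_isomorphic_lex_sum
      antichain_convex A_normal A_antichain | assumption)+
qed

end
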